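(* The following two identities form a basis of identities for the variety of nearlattices $(L,m)$: \begin{align*} m(x,y,x) &= x, \\ m(m(x,y,z),m(y,m(u,x,z),z),w) &= m(w,w,m(y,m(x,u,z),z)). \end{align*} That is, a ternary algebra $(L,m)$, $m:L\times L\times L\to L$, is a nearlattice if and only if both identities hold for all $x,y,z,u,w\in L$.
   Context: A (order-theoretic) nearlattice is a join semilattice $(L,\lor)$ such that for each $a\in L$ the principal filter $\{x\in L \mid a\le x\}$ is a lattice with respect to the induced order (where $x\le y$ iff $x\lor y=y$); the meet of $x,y$ in this principal filter is denoted $x\land_a y$. To such a structure one associates the ternary operation $$m(x,y,z)=(x\lor z)\land_z(y\lor z),\qquad x,y,z\in L.$$ A ternary algebra $(L,m)$ is called a nearlattice if $m$ arises in this way from some order-theoretic nearlattice on the set $L$ (in which case the join is recovered by $x\lor y=m(x,x,y)$, and $x\land_a y=m(x,y,a)$ for $x,y\ge a$). The class of such ternary algebras is a variety. A basis of identities for a variety is a set of identities whose class of models is exactly that variety. *)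

theory Defs
  imports "HOL-Algebra.Lattice"
begin

text \<open>The underlying set \<open>L\<close> of all structures is the type \<open>'a\<close>.\<close>

definition join_le :: "('a \<Rightarrow> 'a \<Rightarrow> 'a) \<Rightarrow> 'a \<Rightarrow> 'a \<Rightarrow> bool" where
  "join_le j x y \<longleftrightarrow> j x y = y"

definition principal_filter :: "('a \<Rightarrow> 'a \<Rightarrow> 'a) \<Rightarrow> 'a \<Rightarrow> 'a gorder" where
  "principal_filter j a = \<lparr>carrier = {x. join_le j a x}, eq = (=), le = join_le j\<rparr>"

definition order_nearlattice :: "('a \<Rightarrow> 'a \<Rightarrow> 'a) \<Rightarrow> bool" where
  "order_nearlattice j \<longleftrightarrow> semilattice j \<and> (\<forall>a. lattice (principal_filter j a))"

text \<open>The meet below is the HOL-Algebra meet in the poset \<open>principal_filter j z\<close>; both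
  of its arguments lie in the carrier of this poset.\<close>

definition nearlattice_op :: "('a \<Rightarrow> 'a \<Rightarrow> 'a) \<Rightarrow> 'a \<Rightarrow> 'a \<Rightarrow> 'a \<Rightarrow> 'a" where
  "nearlattice_op j x y z = j x z \<sqinter>\<^bsub>principal_filter j z\<^esub> j y z"

definition nearlattice :: "('a \<Rightarrow> 'a \<Rightarrow> 'a \<Rightarrow> 'a) \<Rightarrow> bool" where
  "nearlattice m \<longleftrightarrow> (\<exists>j. order_nearlattice j \<and> m = nearlattice_op j)"

end

theory Submission
  imports Defs
begin

text \<open>Write \<open>x \<le> y\<close> for \<open>m x x y = y\<close>, and think of \<open>z\<close> as a fixed base point and of
  \<open>m x y z\<close> as a product \<open>xy\<close> that depends on \<open>z\<close>.

  In a nearlattice \<open>xy\<close> is the meet of \<open>x \<or> z\<close> and \<open>y \<or> z\<close> above \<open>z\<close>. Both \<open>y(ux)\<close> and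
  \<open>y(xu)\<close> are then the triple meet, which lies below \<open>xy\<close>. The second identity compares these two
  comparable elements over a new base point \<open>w\<close>: their joins with \<open>w\<close> have as meet the smaller of
  the two joins (\<open>op_comparable\<close>).

  Conversely, let the two identities hold. Identifying variables shows that \<open>\<le>\<close> is reflexive and
  antisymmetric, that every product lies above its base point, and that \<open>m q p w\<close> is the join of
  \<open>p\<close> and \<open>w\<close> whenever \<open>p \<le> q\<close> (\<open>op_of_le\<close>). Taking \<open>w = xy\<close> in the second identity yields
  \<open>y(xu) \<le> xy\<close> (\<open>exchange_le\<close>), and taking \<open>w = z\<close> yields \<open>y(xu) = (xy)(y(ux))\<close> (\<open>exchange_eq\<close>).
  Instances of the inequality, combined with \<open>op_of_le\<close>, give transitivity of \<open>\<le>\<close> and show that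
  \<open>m x x y\<close> is the least upper bound of \<open>x\<close> and \<open>y\<close>. They also show that the product is monotone
  and commutative on the elements above \<open>z\<close>. Hence the right side of the equation lies below both
  of its factors, so that \<open>y(xu) \<le> y(ux)\<close> (\<open>exchange_le2\<close>), and this makes the product commutative
  on all elements. A commutative product that is monotone and idempotent above \<open>z\<close> and satisfies
  \<open>xy \<le> x \<or> z\<close> is the meet in the principal filter of \<open>z\<close>.\<close>

section \<open>Principal filters of a join semilattice\<close>

locale join_semilattice = semilattice j
  for j :: "'a \<Rightarrow> 'a \<Rightarrow> 'a"
begin

abbreviation le :: "'a \<Rightarrow> 'a \<Rightarrow> bool" (infix "\<preceq>" 50) where
  "x \<preceq> y \<equiv> join_le j x y"

lemma le_refl: "x \<preceq> x"
  by (simp add: join_le_def)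

lemma le_trans: "x \<preceq> y \<Longrightarrow> y \<preceq> z \<Longrightarrow> x \<preceq> z"
  unfolding join_le_def by (metis assoc)

lemma le_antisym: "x \<preceq> y \<Longrightarrow> y \<preceq> x \<Longrightarrow> x = y"
  unfolding join_le_def by (metis commute)

lemma le_join1: "x \<preceq> j x y"
  by (simp add: join_le_def)

lemma le_join2: "y \<preceq> j x y"
  using le_join1[of y x] by (simp add: commute)

lemma join_least: "x \<preceq> z \<Longrightarrow> y \<preceq> z \<Longrightarrow> j x y \<preceq> z"
  unfolding join_le_def by (metis assoc)

text \<open>A principal filter inherits all joins of the semilattice, so that only the meets are at
  stake.\<close>

lemma lattice_principal_filterI:
  assumes meets: "\<And>x y. a \<preceq> x \<Longrightarrow> a \<preceq> y \<Longrightarrow>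
    \<exists>s. a \<preceq> s \<and> s \<preceq> x \<and> s \<preceq> y \<and> (\<forall>w. a \<preceq> w \<longrightarrow> w \<preceq> x \<longrightarrow> w \<preceq> y \<longrightarrow> w \<preceq> s)"
  shows "lattice (principal_filter j a)"
proof unfold_locales
  fix x y
  assume "x \<in> carrier (principal_filter j a)" "y \<in> carrier (principal_filter j a)"
  then have xy: "a \<preceq> x" "a \<preceq> y"
    by (simp_all add: principal_filter_def)
  then have "is_lub (principal_filter j a) (j x y) {x, y}"
    unfolding least_def Upper_def principal_filter_def
    by (auto intro: le_join1 le_join2 join_least le_trans[OF _ le_join1])
  then show "\<exists>s. is_lub (principal_filter j a) s {x, y}" ..
  obtain s where "a \<preceq> s" "s \<preceq> x" "s \<preceq> y" "\<forall>w. a \<preceq> w \<longrightarrow> w \<preceq> x \<longrightarrow> w \<preceq> y \<longrightarrow> w \<preceq> s"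
    using meets[OF xy] by blast
  then have "is_glb (principal_filter j a) s {x, y}"
    using xy unfolding greatest_def Lower_def principal_filter_def by auto
  then show "\<exists>s. is_glb (principal_filter j a) s {x, y}" ..
qed (auto simp: principal_filter_def intro: le_refl le_antisym dest: le_trans)

end

section \<open>The ternary operation of a nearlattice satisfies the identities\<close>

locale nearlattice_join = join_semilattice +
  assumes lattice_filter: "lattice (principal_filter j a)"
begin

abbreviation op :: "'a \<Rightarrow> 'a \<Rightarrow> 'a \<Rightarrow> 'a" where
  "op \<equiv> nearlattice_op j"

lemma base_le_op: "z \<preceq> op x y z"
  and op_le1: "op x y z \<preceq> j x z"
  and op_le2: "op x y z \<preceq> j y z"
  and op_greatest: "z \<preceq> w \<Longrightarrow> w \<preceq> j x z \<Longrightarrow> w \<preceq> j y z \<Longrightarrow> w \<preceq> op x y z"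
proof -
  interpret F: lattice "principal_filter j z"
    by (rule lattice_filter)
  have xy: "j x z \<in> carrier (principal_filter j z)" "j y z \<in> carrier (principal_filter j z)"
    by (simp_all add: principal_filter_def le_join2)
  show "z \<preceq> op x y z"
    using F.meet_closed[OF xy] by (simp add: principal_filter_def nearlattice_op_def)
  show "op x y z \<preceq> j x z"
    using F.meet_left[OF xy] by (simp add: principal_filter_def nearlattice_op_def)
  show "op x y z \<preceq> j y z"
    using F.meet_right[OF xy] by (simp add: principal_filter_def nearlattice_op_def)
  show "w \<preceq> op x y z" if "z \<preceq> w" "w \<preceq> j x z" "w \<preceq> j y z"
    using F.meet_le[of w, OF _ _ xy] that by (simp add: principal_filter_def nearlattice_op_def)
qed

lemma op_eqI:
  assumes "z \<preceq> s" "s \<preceq> j x z" "s \<preceq> j y z"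
    and "\<And>w. z \<preceq> w \<Longrightarrow> w \<preceq> j x z \<Longrightarrow> w \<preceq> j y z \<Longrightarrow> w \<preceq> s"
  shows "op x y z = s"
  by (rule le_antisym) (simp_all add: assms base_le_op op_le1 op_le2 op_greatest)

lemma op_commute: "op x y z = op y x z"
  unfolding nearlattice_op_def by (rule meet_comm)

text \<open>The join with \<open>z\<close> is monotone, so the meet is one of the two joins.\<close>

lemma op_comparable:
  assumes "x \<preceq> y"
  shows "op x y z = j x z"
proof (rule op_eqI)
  show "j x z \<preceq> j y z"
    using assms by (meson join_least le_join1 le_join2 le_trans)
qed (simp_all add: le_refl le_join2)

lemma op_base: "op x y x = x"
  by (rule op_eqI) (simp_all add: le_refl le_join2)

lemma op_exchange: "op (op x y z) (op y (op u x z) z) w = op w w (op y (op x u z) z)"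
proof -
  define t where "t = op y (op u x z) z"
  have "t \<preceq> j (op u x z) z"
    unfolding t_def by (rule op_le2)
  also have "\<dots> \<preceq> j x z"
    by (intro join_least op_le2 le_join2)
  finally (le_trans) have "t \<preceq> j x z" .
  then have "t \<preceq> op x y z"
    unfolding t_def by (intro op_greatest base_le_op op_le1)
  then have "op t (op x y z) w = j t w"
    by (rule op_comparable)
  moreover have "op w w t = j w t"
    by (rule op_comparable) (rule le_refl)
  moreover have "op y (op x u z) z = t"
    by (simp add: t_def op_commute[of x u])
  ultimately show ?thesis
    by (simp add: t_def op_commute[of "op x y z"] commute[of w])
qed

end

lemma order_nearlattice_iff: "order_nearlattice j \<longleftrightarrow> nearlattice_join j"
  by (simp add: order_nearlattice_def nearlattice_join_def join_semilattice_def
      nearlattice_join_axioms_def)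

section \<open>The order defined by the identities\<close>

locale nearlattice_identities =
  fixes m :: "'a \<Rightarrow> 'a \<Rightarrow> 'a \<Rightarrow> 'a"
  assumes base: "m x y x = x"
    and exchange: "m (m x y z) (m y (m u x z) z) w = m w w (m y (m x u z) z)"
begin

abbreviation join :: "'a \<Rightarrow> 'a \<Rightarrow> 'a" where
  "join x y \<equiv> m x x y"

abbreviation le :: "'a \<Rightarrow> 'a \<Rightarrow> bool" (infix "\<preceq>" 50) where
  "x \<preceq> y \<equiv> join_le join x y"

lemma le_iff: "x \<preceq> y \<longleftrightarrow> m x x y = y"
  by (simp add: join_le_def)

lemma le_refl: "x \<preceq> x"
  by (simp add: le_iff base)

text \<open>With \<open>z := y\<close> in the exchange identity, the factor \<open>y(ux)\<close> on the left and the term \<open>y(xu)\<close> on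
  the right both collapse to the base point.\<close>

lemma op_op_base: "m (m x y y) y w = join w y"
  using exchange[of x y y x w] by (simp add: base)

lemma join_commute: "join x y = join y x"
  using op_op_base[of x x y] by (simp add: base)

lemma le_antisym: "x \<preceq> y \<Longrightarrow> y \<preceq> x \<Longrightarrow> x = y"
  using join_commute[of x y] by (simp add: le_iff)

lemma op_same_base: "m x y y = y"
proof -
  have "y \<preceq> m x y y"
    using op_op_base[of x y "m x y y"] join_commute[of y "m x y y"] by (simp add: le_iff base)
  moreover have "m x y y \<preceq> y"
    using exchange[of y x y y y] join_commute[of y "m x y y"] by (simp add: le_iff base)
  ultimately show ?thesis
    by (simp add: le_antisym)
qed

text \<open>With \<open>w\<close> chosen as the first argument of the left side, that side reduces to \<open>w\<close>.\<close>

lemma exchange_le: "m y (m x u z) z \<preceq> m x y z"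
  using exchange[of x y z u "m x y z"] join_commute[of "m x y z"] by (simp add: le_iff base)

lemma base_le_op: "z \<preceq> m x y z"
  using exchange_le[of y x z z] by (simp add: op_same_base)

lemma le_join1: "x \<preceq> join x y"
  using base_le_op[of x y y] join_commute[of x y] by simp

text \<open>The exchange inequality for \<open>y := xy\<close> and \<open>u := y\<close>; its left side is \<open>(xy)(xy) = xy\<close>.\<close>

lemma op_le_op_op: "m x y z \<preceq> m x (m x y z) z"
proof -
  have "m (m x y z) (m x y z) z = m x y z"
    using base_le_op[of z x y] join_commute[of z "m x y z"] by (simp add: le_iff)
  then show ?thesis
    using exchange_le[of "m x y z" x y z] by simp
qed

text \<open>With base point \<open>q\<close>, both \<open>px \<le> p(px)\<close> and \<open>p(px) \<le> pp = q\<close> hold; since \<open>q\<close> is also a lower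
  bound of every product, first \<open>p(px)\<close> and then \<open>px\<close> is \<open>q\<close>. The
  argument avoids transitivity, which is itself a consequence of this lemma.\<close>

lemma op_absorb:
  assumes "p \<preceq> q"
  shows "m p x q = q"
proof (rule le_antisym)
  have "m p (m p x q) q \<preceq> q"
    using exchange_le[of p p x q] assms by (simp add: le_iff)
  then have "m p (m p x q) q = q"
    by (rule le_antisym) (rule base_le_op)
  then show "m p x q \<preceq> q"
    using op_le_op_op[of p x q] by simp
qed (rule base_le_op)

lemma op_of_le:
  assumes "p \<preceq> q"
  shows "m q p w = join p w"
proof -
  have "m q q p = q"
    using assms join_commute[of p q] by (simp add: le_iff)
  \<comment> \<open>so \<open>q\<close> is a product with base point \<open>p\<close>\<close>
  then show ?thesis
    using exchange[of q q p p w] join_commute[of w p] by (simp add: base op_same_base)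
qed

lemma le_trans:
  assumes "p \<preceq> q" "q \<preceq> r"
  shows "p \<preceq> r"
proof -
  \<comment> \<open>evaluate \<open>m q p r\<close> in two ways\<close>
  have "join p r = m q p r"
    using assms(1) by (simp add: op_of_le)
  also have "\<dots> = r"
    using assms(2) by (rule op_absorb)
  finally show ?thesis
    by (simp add: le_iff)
qed

text \<open>Two exchange inequalities: \<open>xy \<le> x(xy) \<le> xx\<close>.\<close>

lemma op_le1: "m x y z \<preceq> join x z"
  using op_le_op_op exchange_le by (rule le_trans)

lemma join_least:
  assumes "p \<preceq> r" "q \<preceq> r"
  shows "join p q \<preceq> r"
proof -
  have "join p q = m r p q"
    using assms(1) by (simp add: op_of_le)
  moreover have "join r q = r"
    using assms(2) join_commute[of r q] by (simp add: le_iff)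
  ultimately show ?thesis
    using op_le1[of r p q] by simp
qed

lemma semilattice_join: "semilattice join"
proof
  have le_join2: "y \<preceq> join x y" for x y
    using le_join1[of y x] by (simp add: join_commute[of x y])
  show "join (join x y) z = join x (join y z)" for x y z
    by (rule le_antisym)
      (blast intro: join_least le_join1 le_join2 le_trans[OF le_join1 le_join1]
        le_trans[OF le_join2 le_join1] le_trans[OF le_join1 le_join2]
        le_trans[OF le_join2 le_join2])+
qed (rule join_commute, rule base)

section \<open>Meets in principal filters\<close>

text \<open>Above \<open>z\<close> one has \<open>x = xx\<close>, so the exchange inequality with \<open>u := x\<close> reads \<open>yx \<le> xy\<close>.\<close>

lemma op_commute_above:
  assumes "z \<preceq> x" "z \<preceq> y"
  shows "m x y z = m y x z"
proof -
  have "m x x z = x" "m y y z = y"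
    using assms by (simp_all add: le_iff join_commute[of _ z])
  then show ?thesis
    using exchange_le[of x y y z] exchange_le[of y x x z] by (simp add: le_antisym)
qed

text \<open>Here \<open>p = qp\<close>, so this is the exchange inequality \<open>y(qp) \<le> qy\<close>.\<close>

lemma op_mono_swap:
  assumes "z \<preceq> p" "p \<preceq> q"
  shows "m y p z \<preceq> m q y z"
proof -
  have "m q p z = p"
    using op_of_le[OF assms(2), of z] assms(1) by (simp add: le_iff join_commute[of p z])
  then show ?thesis
    using exchange_le[of y q p z] by simp
qed

lemma exchange_eq: "m y (m x u z) z = m (m x y z) (m y (m u x z) z) z"
  using exchange[of x y z u z] base_le_op[of z y "m x u z"] by (simp add: le_iff)

text \<open>By the exchange equation the left side is a product of two elements above \<open>z\<close>. These commute,
  so the product lies below the second of them as well.\<close>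

lemma exchange_le2: "m y (m x u z) z \<preceq> m y (m u x z) z"
proof -
  have "m y (m x u z) z = m (m y (m u x z) z) (m x y z) z"
    using exchange_eq op_commute_above[OF base_le_op base_le_op] by metis
  also have "\<dots> \<preceq> join (m y (m u x z) z) z"
    by (rule op_le1)
  also have "join (m y (m u x z) z) z = m y (m u x z) z"
    using base_le_op[of z y "m u x z"] by (simp add: le_iff join_commute[of _ z])
  finally show ?thesis .
qed

text \<open>Each order of the factors lies below the other: \<open>yx \<le> y(yx) \<le> y(xy) \<le> xy\<close>.\<close>

lemma op_commute: "m x y z = m y x z"
proof -
  have "m y x z \<preceq> m x y z" for x y
    using op_le_op_op[of y x z] exchange_le2[of y y x z] exchange_le[of y x y z]
    by (blast intro: le_trans)
  then show ?thesis
    by (blast intro: le_antisym)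
qed

lemma op_le2: "m x y z \<preceq> join y z"
  using op_le1[of y x z] by (simp add: op_commute)

text \<open>By monotonicity, \<open>w = ww \<le> (x \<or> z)w \<le> (y \<or> z)(x \<or> z)\<close>, and the exchange inequality removes
  the two joins again.\<close>

lemma op_greatest:
  assumes "z \<preceq> w" "w \<preceq> join x z" "w \<preceq> join y z"
  shows "w \<preceq> m x y z"
proof -
  have "w = m w w z"
    using assms(1) by (simp add: le_iff join_commute[of w z])
  also have "m w w z \<preceq> m (join x z) w z"
    using assms(1,2) by (rule op_mono_swap)
  finally have "w \<preceq> m (join x z) w z" .
  moreover have "m (join x z) w z \<preceq> m (join y z) (join x z) z"
    using assms(1,3) by (rule op_mono_swap)
  moreover have "m (join y z) (join x z) z \<preceq> m x (join y z) z"
    by (rule exchange_le)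
  moreover have "m x (join y z) z \<preceq> m x y z"
    using exchange_le[of x y y z] by (simp add: op_commute)
  ultimately show ?thesis
    by (blast intro: le_trans)
qed

lemma lattice_filter: "lattice (principal_filter join a)"
proof (rule join_semilattice.lattice_principal_filterI)
  show "join_semilattice join"
    by (intro join_semilattice.intro semilattice_join)
next
  fix x y
  assume "a \<preceq> x" "a \<preceq> y"
  then have "join x a = x" and "join y a = y"
    using join_commute[of x a] join_commute[of y a] by (simp_all only: le_iff)
  then have "m x y a \<preceq> x" "m x y a \<preceq> y" "\<forall>w. a \<preceq> w \<longrightarrow> w \<preceq> x \<longrightarrow> w \<preceq> y \<longrightarrow> w \<preceq> m x y a"
    using op_le1[of x y a] op_le2[of x y a] op_greatest[of a _ x y] by simp_all
  with base_le_op
  show "\<exists>s. a \<preceq> s \<and> s \<preceq> x \<and> s \<preceq> y \<and> (\<forall>w. a \<preceq> w \<longrightarrow> w \<preceq> x \<longrightarrow> w \<preceq> y \<longrightarrow> w \<preceq> s)"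
    by (intro exI[of _ "m x y a"] conjI)
qed

lemma nearlattice_join: "nearlattice_join join"
  by (rule nearlattice_join.intro[OF join_semilattice.intro[OF semilattice_join]
        nearlattice_join_axioms.intro[OF lattice_filter]])

lemma nearlattice_op_join: "nearlattice_op join x y z = m x y z"
proof -
  interpret J: nearlattice_join join
    by (rule nearlattice_join)
  show ?thesis
    by (intro J.op_eqI base_le_op op_le1 op_le2) (rule op_greatest)
qed

end

section \<open>The two identities form a basis\<close>

theorem theorem1p2:
  fixes m :: "'a \<Rightarrow> 'a \<Rightarrow> 'a \<Rightarrow> 'a"
  shows "nearlattice m \<longleftrightarrow>
    (\<forall>x y. m x y x = x) \<and>
    (\<forall>x y z u w.
      m (m x y z) (m y (m u x z) z) w = m w w (m y (m x u z) z))"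
proof
  assume "nearlattice m"
  then obtain j where "order_nearlattice j" and m: "m = nearlattice_op j"
    by (auto simp: nearlattice_def)
  interpret nearlattice_join j
    using \<open>order_nearlattice j\<close> by (simp add: order_nearlattice_iff)
  show "(\<forall>x y. m x y x = x) \<and>
    (\<forall>x y z u w. m (m x y z) (m y (m u x z) z) w = m w w (m y (m x u z) z))"
    unfolding m by (intro conjI allI op_base op_exchange)
next
  assume "(\<forall>x y. m x y x = x) \<and>
    (\<forall>x y z u w. m (m x y z) (m y (m u x z) z) w = m w w (m y (m x u z) z))"
  then interpret nearlattice_identities m
    by unfold_locales blast+
  have "m = nearlattice_op join"
    by (intro ext) (simp add: nearlattice_op_join)
  then show "nearlattice m"
    unfolding nearlattice_def using nearlattice_join by (auto simp: order_nearlattice_iff)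
qed

end
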